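(* Let $E=\mathbb{R}^n$ be a real $n$-dimensional evolution algebra with matrix of structural constants $M=(a_{ij})$, let $\operatorname{rank}(M)=n-2$, and suppose that $\det(M_{n-2})\neq0$, where $M_{n-2}=(a_{ik})_{i,k=1,\dots,n-2}$. Let $d_{ij}$ ($1\le i\le n-2$, $j\in\{n-1,n\}$) be the numbers defined in the context. Then $E$ has the unique absolute nilpotent element $(0,\dots,0)$ if and only if one of the following conditions is satisfied: (i) $d_{i_0,n-1}>0$ and $d_{i_0,n}>0$ for some $i_0\in\{1,\dots,n-2\}$; (ii) there are $k,m\in\{1,\dots,n-2\}$ such that either $d_{k,n-1}>0$, $d_{k,n}=0$, $d_{m,n}>0$, or $d_{k,n-1}=0$, $d_{k,n}>0$, $d_{m,n-1}>0$; (iii) there are $s,t\in\{1,\dots,n-2\}$ with $d_{s,n-1}>0$, $d_{s,n}<0$ and $d_{t,n-1}<0$, $d_{t,n}>0$, and $$\max_t\Big\{\frac{-d_{t,n}}{d_{t,n-1}}: d_{t,n-1}<0,\ d_{t,n}>0\Big\}>\min_s\Big\{\frac{-d_{s,n}}{d_{s,n-1}}: d_{s,n-1}>0,\ d_{s,n}<0\Big\}.$$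
   Context: An evolution algebra is an algebra with a basis $e_1,\dots,e_n$ (natural basis) such that $e_ie_j=0$ for $i\ne j$ and $e_ie_i=\sum_k a_{ik}e_k$; $M=(a_{ij})$ is its matrix of structural constants. An element $x$ is absolute nilpotent if $x^2=0$; for $x=\sum_i x_ie_i$ this is the system $\sum_{i=1}^n a_{ij}x_i^2=0$, $j=1,\dots,n$. With $r=n-2$ and $M_r=(a_{ik})_{i,k=1,\dots,r}$, put $d_{ij}=\det(M_{ij}^T)/\det(M_r)$ for $i=1,\dots,r$, $j=r+1,\dots,n$, where $M_{ij}^T$ is the $r\times r$ matrix obtained from the transpose of $M_r$ by replacing its $i$-th column $(a_{i1},\dots,a_{ir})^T$ by $(a_{j1},a_{j2},\dots,a_{jr})^T$. *)

theory Defs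
  imports "Jordan_Normal_Form.DL_Rank" "Jordan_Normal_Form.Determinant"
begin

text \<open>
  Indices are 0-based, as usual for vectors and matrices here: the mathematical index
  \<open>i \<in> {1, \<dots>, n}\<close> is rendered as \<open>i - 1 \<in> {0, \<dots>, n - 1}\<close>.
\<close>

definition bilinear_product :: "nat \<Rightarrow> ('a::field vec \<Rightarrow> 'a vec \<Rightarrow> 'a vec) \<Rightarrow> bool" where
  "bilinear_product n mul \<longleftrightarrow>
     (\<forall>x \<in> carrier_vec n. \<forall>y \<in> carrier_vec n. mul x y \<in> carrier_vec n) \<and>
     (\<forall>x \<in> carrier_vec n. \<forall>y \<in> carrier_vec n. \<forall>z \<in> carrier_vec n.
        mul (x + y) z = mul x z + mul y z \<and> mul x (y + z) = mul x y + mul x z) \<and>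
     (\<forall>c. \<forall>x \<in> carrier_vec n. \<forall>y \<in> carrier_vec n.
        mul (c \<cdot>\<^sub>v x) y = c \<cdot>\<^sub>v mul x y \<and> mul x (c \<cdot>\<^sub>v y) = c \<cdot>\<^sub>v mul x y)"

text \<open>The natural basis \<open>e\<close> may be any basis of the space, not just the unit vectors.\<close>

definition evolution_algebra ::
    "nat \<Rightarrow> ('a::field vec \<Rightarrow> 'a vec \<Rightarrow> 'a vec) \<Rightarrow> (nat \<Rightarrow> 'a vec) \<Rightarrow> 'a mat \<Rightarrow> bool" where
  "evolution_algebra n mul e M \<longleftrightarrow>
     bilinear_product n mul \<and>
     inj_on e {..<n} \<and>
     vectorspace.basis class_ring (module_vec TYPE('a) n) (e ` {..<n}) \<and>
     M \<in> carrier_mat n n \<and>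
     (\<forall>i<n. \<forall>j<n. i \<noteq> j \<longrightarrow> mul (e i) (e j) = 0\<^sub>v n) \<and>
     (\<forall>i<n. mul (e i) (e i) = finsum_vec TYPE('a) n (\<lambda>k. M $$ (i, k) \<cdot>\<^sub>v e k) {..<n})"

definition absolute_nilpotent ::
    "nat \<Rightarrow> ('a::field vec \<Rightarrow> 'a vec \<Rightarrow> 'a vec) \<Rightarrow> 'a vec \<Rightarrow> bool" where
  "absolute_nilpotent n mul x \<longleftrightarrow> x \<in> carrier_vec n \<and> mul x x = 0\<^sub>v n"

definition leading_block :: "nat \<Rightarrow> 'a mat \<Rightarrow> 'a mat" where
  "leading_block r M = mat r r (\<lambda>(i, k). M $$ (i, k))"

text \<open>Meaningful for \<open>i < r \<le> j < n\<close> and an invertible leading block.\<close>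

definition d_coeff :: "nat \<Rightarrow> 'a::field mat \<Rightarrow> nat \<Rightarrow> nat \<Rightarrow> 'a" where
  "d_coeff r M i j =
     det (replace_col (transpose_mat (leading_block r M)) (vec r (\<lambda>k. M $$ (j, k))) i)
       / det (leading_block r M)"

end

theory Submission
  imports Defs
begin

text \<open>
  In the natural basis the square of \<open>\<Sum>\<^sub>i c\<^sub>i e\<^sub>i\<close> has the coordinates
  \<open>\<Sum>\<^sub>i c\<^sub>i\<^sup>2 a\<^sub>i\<^sub>k\<close>, so absolute nilpotent elements correspond to vectors in the left kernel of
  \<open>M\<close> that are entrywise squares, that is, over the reals, to entrywise nonnegative
  vectors \<open>y\<close> with \<open>y M = 0\<close> (\<open>unique_absolute_nilpotent_iff\<close>).

  When the rank is \<open>r\<close> and the leading \<open>r \<times> r\<close> block is invertible, the first \<open>r\<close> columns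
  span the column space, so only the first \<open>r\<close> equations of \<open>y M = 0\<close> matter. By Cramer's
  rule the numbers \<open>d\<^sub>i\<^sub>j\<close> express the first \<open>r\<close> entries of row \<open>j\<close> through those of the
  first \<open>r\<close> rows, so the left kernel is the graph
  \<open>y\<^sub>i = - \<Sum>\<^sub>j d\<^sub>i\<^sub>j y\<^sub>j\<close> (\<open>i < r \<le> j\<close>) over the free coordinates (\<open>left_kernel_iff\<close>).

  With two free coordinates \<open>u, v \<ge> 0\<close> a nonzero nonnegative solution is a nonzero point of the
  closed quadrant where all the forms \<open>p\<^sub>i u + q\<^sub>i v\<close>, with \<open>p\<^sub>i\<close> and \<open>q\<^sub>i\<close> the two columns of the
  \<open>d\<^sub>i\<^sub>j\<close>, are nonpositive. Uniqueness thus says that the open half-planes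
  \<open>p\<^sub>i u + q\<^sub>i v > 0\<close> cover the closed quadrant minus the origin. The two boundary rays are covered
  when some \<open>p\<^sub>i\<close> and some \<open>q\<^sub>j\<close> are positive; the parameters
  \<open>w = u / v\<close> of the interior rays covered by the form \<open>i\<close> are all \<open>w > 0\<close> if both coefficients are
  nonnegative and not both zero, those with \<open>w > - q\<^sub>i / p\<^sub>i\<close> if \<open>p\<^sub>i > 0 > q\<^sub>i\<close>, those with
  \<open>w < - q\<^sub>i / p\<^sub>i\<close> if \<open>p\<^sub>i < 0 < q\<^sub>i\<close>, and none otherwise. Comparing the end points gives the three alternatives
  (\<open>half_planes_cover_quadrant_iff\<close>).
\<close>

section \<open>Squares in coordinates\<close>

lemma linear_map_finsum_vec:
  fixes f :: "'a::field vec \<Rightarrow> 'a vec"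
  assumes "\<And>x. x \<in> carrier_vec n \<Longrightarrow> f x \<in> carrier_vec m"
    and "\<And>x y. x \<in> carrier_vec n \<Longrightarrow> y \<in> carrier_vec n \<Longrightarrow> f (x + y) = f x + f y"
    and "\<And>c x. x \<in> carrier_vec n \<Longrightarrow> f (c \<cdot>\<^sub>v x) = c \<cdot>\<^sub>v f x"
    and "finite F" "\<And>i. i \<in> F \<Longrightarrow> v i \<in> carrier_vec n"
  shows "f (finsum_vec TYPE('a) n (\<lambda>i. c i \<cdot>\<^sub>v v i) F)
    = finsum_vec TYPE('a) m (\<lambda>i. c i \<cdot>\<^sub>v f (v i)) F"
  using assms(4,5)
proof (induction F)
  case empty
  have "0 \<cdot>\<^sub>v 0\<^sub>v n = (0\<^sub>v n :: 'a vec)" by auto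
  then have "f (0\<^sub>v n) = f (0 \<cdot>\<^sub>v 0\<^sub>v n)" by simp
  also have "\<dots> = 0\<^sub>v m"
    using assms(1)[of "0\<^sub>v n"] assms(3)[of "0\<^sub>v n" 0] by auto
  finally show ?case by (simp add: finsum_vec_empty)
next
  case (insert i F)
  have 1: "(\<lambda>i. c i \<cdot>\<^sub>v v i) \<in> F \<rightarrow> carrier_vec n" "c i \<cdot>\<^sub>v v i \<in> carrier_vec n"
    using insert.prems by auto
  have 2: "(\<lambda>i. c i \<cdot>\<^sub>v f (v i)) \<in> F \<rightarrow> carrier_vec m" "c i \<cdot>\<^sub>v f (v i) \<in> carrier_vec m"
    using insert.prems assms(1) by auto
  show ?case
    unfolding finsum_vec_insert[OF insert.hyps 1] finsum_vec_insert[OF insert.hyps 2]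
    using insert 1 assms(2,3) finsum_vec_closed[OF 1(1)] by simp
qed

definition coord_sum :: "nat \<Rightarrow> (nat \<Rightarrow> 'a::field vec) \<Rightarrow> (nat \<Rightarrow> 'a) \<Rightarrow> 'a vec" where
  "coord_sum n e c = finsum_vec TYPE('a) n (\<lambda>i. c i \<cdot>\<^sub>v e i) {..<n}"

lemma coord_sum_carrier:
  assumes "\<And>i. i < n \<Longrightarrow> e i \<in> carrier_vec n"
  shows "coord_sum n e c \<in> carrier_vec n"
  unfolding coord_sum_def by (rule finsum_vec_closed) (use assms in auto)

lemma coord_sum_index:
  assumes "\<And>i. i < n \<Longrightarrow> e i \<in> carrier_vec n" "j < n"
  shows "coord_sum n e c $ j = (\<Sum>i<n. c i * e i $ j)"
proof -
  have "coord_sum n e c $ j = (\<Sum>i<n. (c i \<cdot>\<^sub>v e i) $ j)"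
    unfolding coord_sum_def by (rule index_finsum_vec) (use assms in auto)
  also have "\<dots> = (\<Sum>i<n. c i * e i $ j)"
  proof (rule sum.cong)
    fix i assume "i \<in> {..<n}"
    then have "dim_vec (e i) = n" using assms(1) carrier_vecD by blast
    then show "(c i \<cdot>\<^sub>v e i) $ j = c i * e i $ j" using assms(2) by simp
  qed simp
  finally show ?thesis .
qed

text \<open>
  The matrix with columns \<open>e\<^sub>i\<close> maps coordinate vectors to elements. Independence of the columns
  makes its kernel trivial, so it is invertible, which gives existence and uniqueness of
  coordinates at once.
\<close>
lemma basis_coordinates:
  fixes e :: "nat \<Rightarrow> 'a::field vec"
  assumes inj: "inj_on e {..<n}"
    and basis: "vectorspace.basis class_ring (module_vec TYPE('a) n) (e ` {..<n})"
  shows "i < n \<Longrightarrow> e i \<in> carrier_vec n"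
    and "x \<in> carrier_vec n \<Longrightarrow> \<exists>c. x = coord_sum n e c"
    and "coord_sum n e c = 0\<^sub>v n \<longleftrightarrow> (\<forall>i<n. c i = 0)"
proof -
  interpret vec_space "TYPE('a)" n .
  have lin: "lin_indpt (e ` {..<n})" and car: "e ` {..<n} \<subseteq> carrier_vec n"
    using basis unfolding basis_def by auto
  then show e: "e i \<in> carrier_vec n" if "i < n" for i
    using that by auto
  define P where "P = mat_of_cols n (map e [0..<n])"
  have P: "P \<in> carrier_mat n n"
    unfolding P_def by (simp add: mat_of_cols_def)
  have colsP: "cols P = map e [0..<n]"
    unfolding P_def by (rule cols_mat_of_cols) (use car in \<open>auto simp: image_subset_iff\<close>)
  have dist: "distinct (cols P)"
    using inj by (simp add: colsP distinct_map atLeast0LessThan)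
  have setP: "set (cols P) = e ` {..<n}"
    by (auto simp: colsP)
  have P_mult: "P *\<^sub>v vec n c = coord_sum n e c" for c
  proof (rule eq_vecI)
    fix j assume "j < dim_vec (coord_sum n e c)"
    then have j: "j < n" using coord_sum_carrier[of n e c] e by auto
    show "(P *\<^sub>v vec n c) $ j = coord_sum n e c $ j"
      using P j by (auto simp: coord_sum_index e scalar_prod_def P_def mat_of_cols_def
          atLeast0LessThan mult.commute intro!: sum.cong)
  qed (use P coord_sum_carrier[of n e c] e in auto)
  have inj0: "v = 0\<^sub>v n" if "v \<in> carrier_vec n" "P *\<^sub>v v = 0\<^sub>v n" for v
    using lin_depI[OF P that(1) _ that(2) dist] lin setP by auto
  have "det P \<noteq> 0"
    using det_0_iff_vec_prod_zero_field[OF P] inj0 by auto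
  then obtain Q where Q: "Q \<in> carrier_mat n n" "P * Q = 1\<^sub>m n"
    using det_non_zero_imp_unit[OF P] P unfolding Units_def by (auto simp: ring_mat_simps)
  show "\<exists>c. x = coord_sum n e c" if x: "x \<in> carrier_vec n"
  proof -
    have Qx: "Q *\<^sub>v x \<in> carrier_vec n" using Q x by auto
    have "x = P *\<^sub>v (Q *\<^sub>v x)"
      using P Q x by (metis assoc_mult_mat_vec one_mult_mat_vec)
    also have "\<dots> = P *\<^sub>v vec n (\<lambda>i. (Q *\<^sub>v x) $ i)"
      using Qx by (intro arg_cong[of _ _ "\<lambda>w. P *\<^sub>v w"] eq_vecI) (use Q in auto)
    finally show ?thesis using P_mult by metis
  qed
  show "coord_sum n e c = 0\<^sub>v n \<longleftrightarrow> (\<forall>i<n. c i = 0)"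
  proof
    assume "coord_sum n e c = 0\<^sub>v n"
    then have "vec n c = 0\<^sub>v n" using inj0[of "vec n c"] P_mult by auto
    then show "\<forall>i<n. c i = 0" by (metis index_vec index_zero_vec(1))
  next
    assume "\<forall>i<n. c i = 0"
    then show "coord_sum n e c = 0\<^sub>v n"
      using e coord_sum_carrier[of n e c] by (intro eq_vecI) (auto simp: coord_sum_index)
  qed
qed

text \<open>
  Expanding both factors bilinearly, only the diagonal terms \<open>c\<^sub>i\<^sup>2 e\<^sub>i e\<^sub>i\<close> survive.
\<close>
lemma square_coord_sum:
  fixes M :: "'a::field mat"
  assumes E: "evolution_algebra n mul e M"
  shows "mul (coord_sum n e c) (coord_sum n e c)
    = coord_sum n e (\<lambda>k. \<Sum>i<n. (c i)\<^sup>2 * M $$ (i, k))"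
proof -
  have bil: "bilinear_product n mul"
    and mul0: "\<And>i j. i < n \<Longrightarrow> j < n \<Longrightarrow> i \<noteq> j \<Longrightarrow> mul (e i) (e j) = 0\<^sub>v n"
    and mul1: "\<And>i. i < n \<Longrightarrow> mul (e i) (e i) = coord_sum n e (\<lambda>k. M $$ (i, k))"
    using E unfolding evolution_algebra_def coord_sum_def by auto
  have e: "i < n \<Longrightarrow> e i \<in> carrier_vec n" for i
    using E basis_coordinates(1) unfolding evolution_algebra_def by blast
  have x: "coord_sum n e c \<in> carrier_vec n" for c
    by (rule coord_sum_carrier) (rule e)
  have closed: "mul x y \<in> carrier_vec n" if "x \<in> carrier_vec n" "y \<in> carrier_vec n" for x y
    using bil that unfolding bilinear_product_def by blast
  let ?x = "coord_sum n e c"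
  have right: "mul (e i) ?x = (c i) \<cdot>\<^sub>v mul (e i) (e i)" if i: "i < n" for i
  proof -
    have "mul (e i) ?x = finsum_vec TYPE('a) n (\<lambda>j. c j \<cdot>\<^sub>v mul (e i) (e j)) {..<n}"
      unfolding coord_sum_def
      by (rule linear_map_finsum_vec) (use bil e i in \<open>auto simp: bilinear_product_def\<close>)
    also have "\<dots> = (c i) \<cdot>\<^sub>v mul (e i) (e i)" (is "?l = ?r")
    proof (rule eq_vecI)
      have r: "?r \<in> carrier_vec n" using closed e i by auto
      have "?l \<in> carrier_vec n" by (rule finsum_vec_closed) (use closed e i in auto)
      with r show "dim_vec ?l = dim_vec ?r" by auto
      fix k assume "k < dim_vec ?r"
      with r have k: "k < n" by auto
      have "?l $ k = (\<Sum>j<n. (c j \<cdot>\<^sub>v mul (e i) (e j)) $ k)"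
        by (rule index_finsum_vec) (use closed e i k in auto)
      also have "\<dots> = (\<Sum>j<n. if j = i then ?r $ k else 0)"
        by (rule sum.cong) (use mul0[OF i] k in auto)
      also have "\<dots> = ?r $ k" using i by simp
      finally show "?l $ k = ?r $ k" .
    qed
    finally show ?thesis .
  qed
  have left: "mul ?x ?x = finsum_vec TYPE('a) n (\<lambda>i. c i \<cdot>\<^sub>v mul (e i) ?x) {..<n}"
  proof -
    have "mul (finsum_vec TYPE('a) n (\<lambda>i. c i \<cdot>\<^sub>v e i) {..<n}) ?x
      = finsum_vec TYPE('a) n (\<lambda>i. c i \<cdot>\<^sub>v mul (e i) ?x) {..<n}"
      by (rule linear_map_finsum_vec[where f = "\<lambda>y. mul y ?x"])
        (use bil e x in \<open>auto simp: bilinear_product_def\<close>)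
    then show ?thesis by (simp flip: coord_sum_def)
  qed
  show ?thesis
  proof (rule eq_vecI)
    fix k assume "k < dim_vec (coord_sum n e (\<lambda>k. \<Sum>i<n. (c i)\<^sup>2 * M $$ (i, k)))"
    then have k: "k < n" using x by (metis carrier_vecD)
    have "mul ?x ?x $ k = (\<Sum>i<n. (c i \<cdot>\<^sub>v mul (e i) ?x) $ k)"
      unfolding left by (rule index_finsum_vec) (use closed e x k in auto)
    also have "\<dots> = (\<Sum>i<n. (c i)\<^sup>2 * (\<Sum>j<n. M $$ (i, j) * e j $ k))"
      by (rule sum.cong)
        (use k carrier_vecD[OF x] in \<open>auto simp: right mul1 coord_sum_index e power2_eq_square\<close>)
    also have "\<dots> = (\<Sum>j<n. (\<Sum>i<n. (c i)\<^sup>2 * M $$ (i, j)) * e j $ k)"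
      by (simp add: sum_distrib_left sum_distrib_right mult.assoc) (rule sum.swap)
    finally show "mul ?x ?x $ k = coord_sum n e (\<lambda>k. \<Sum>i<n. (c i)\<^sup>2 * M $$ (i, k)) $ k"
      using k by (simp add: coord_sum_index e)
  qed (use closed x x in \<open>metis carrier_vecD\<close>)
qed

lemma unique_absolute_nilpotent_iff:
  fixes M :: "'a::field mat"
  assumes E: "evolution_algebra n mul e M"
  shows "{x. absolute_nilpotent n mul x} = {0\<^sub>v n} \<longleftrightarrow>
    (\<forall>c. (\<forall>k<n. (\<Sum>i<n. (c i)\<^sup>2 * M $$ (i, k)) = 0) \<longrightarrow> (\<forall>i<n. c i = 0))"
proof -
  have inj: "inj_on e {..<n}"
    and basis: "vectorspace.basis class_ring (module_vec TYPE('a) n) (e ` {..<n})"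
    using E unfolding evolution_algebra_def by auto
  note B = basis_coordinates[OF inj basis]
  have nil: "absolute_nilpotent n mul (coord_sum n e c) \<longleftrightarrow>
      (\<forall>k<n. (\<Sum>i<n. (c i)\<^sup>2 * M $$ (i, k)) = 0)" for c
    unfolding absolute_nilpotent_def square_coord_sum[OF E] B(3)
    using coord_sum_carrier[OF B(1)] by simp
  have zero: "absolute_nilpotent n mul (0\<^sub>v n)"
    using nil[of "\<lambda>_. 0"] B(3)[of "\<lambda>_. 0"] by simp
  have "{x. absolute_nilpotent n mul x} = {0\<^sub>v n} \<longleftrightarrow>
      (\<forall>x. absolute_nilpotent n mul x \<longrightarrow> x = 0\<^sub>v n)"
    using zero by auto
  also have "\<dots> \<longleftrightarrow>
      (\<forall>c. absolute_nilpotent n mul (coord_sum n e c) \<longrightarrow> coord_sum n e c = 0\<^sub>v n)"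
    using B(2) unfolding absolute_nilpotent_def by blast
  finally show ?thesis unfolding nil B(3) .
qed

section \<open>The left kernel of a matrix with an invertible leading block of full rank\<close>

text \<open>
  Invertibility of the leading block makes the first \<open>r\<close> columns independent; if a further column
  lay outside their span, it would enlarge them to \<open>r + 1\<close> independent columns, against the rank.
  A vector orthogonal to the first \<open>r\<close> columns is therefore orthogonal to all of them.
\<close>
lemma leading_columns_determine_left_kernel:
  fixes M :: "'a::field mat"
  assumes M: "M \<in> carrier_mat n n" and "r \<le> n"
    and rank: "vec_space.rank n M = r"
    and det: "det (leading_block r M) \<noteq> 0"
    and y: "\<forall>k<r. (\<Sum>i<n. y i * M $$ (i, k)) = 0" and k: "k < n"
  shows "(\<Sum>i<n. y i * M $$ (i, k)) = 0"
proof -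
  interpret vec_space "TYPE('a)" n .
  let ?A = "leading_block r M"
  have A: "?A \<in> carrier_mat r r" by (simp add: leading_block_def)
  define N where "N = mat_of_cols n (map (col M) [0..<r])"
  have N: "N \<in> carrier_mat n r" unfolding N_def by (simp add: mat_of_cols_def)
  have colsN: "cols N = map (col M) [0..<r]"
    unfolding N_def by (rule cols_mat_of_cols) (use M in \<open>auto simp: col_def\<close>)
  let ?S = "set (cols N)"
  have S: "?S = col M ` {..<r}" by (auto simp: colsN)
  have carS: "?S \<subseteq> carrier_vec n" using N cols_dim by blast
  have "inj_on (col M) {..<r}"
  proof (rule inj_onI)
    fix i j assume ij: "i \<in> {..<r}" "j \<in> {..<r}" "col M i = col M j"
    have "col ?A i = col ?A j"
    proof (rule eq_vecI)
      fix l assume "l < dim_vec (col ?A j)"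
      then have l: "l < r" using A by simp
      have "M $$ (l, i) = col M i $ l" "M $$ (l, j) = col M j $ l"
        using M l \<open>r \<le> n\<close> ij(1,2) by auto
      then show "col ?A i $ l = col ?A j $ l"
        using ij l by (simp add: leading_block_def col_def)
    qed simp
    then show "i = j" using det_identical_cols[OF A] det ij by blast
  qed
  then have dist: "distinct (cols N)"
    by (simp add: colsN distinct_map atLeast0LessThan)
  have cardS: "card ?S = r" using distinct_card[OF dist] by (simp add: colsN)
  have indep: "lin_indpt ?S"
  proof
    assume "lin_dep ?S"
    then obtain v where v: "v \<in> carrier_vec r" "v \<noteq> 0\<^sub>v r" "N *\<^sub>v v = 0\<^sub>v n"
      using lin_depE[OF N _ dist] by blast
    have "?A *\<^sub>v v = 0\<^sub>v r"
    proof (rule eq_vecI)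
      fix l assume "l < dim_vec (0\<^sub>v r :: 'a vec)"
      then have l: "l < r" by simp
      have "(?A *\<^sub>v v) $ l = (N *\<^sub>v v) $ l"
        using l v(1) \<open>r \<le> n\<close> M
        by (auto simp: leading_block_def N_def scalar_prod_def mat_of_cols_def intro!: sum.cong)
      then show "(?A *\<^sub>v v) $ l = 0\<^sub>v r $ l" using v(3) l \<open>r \<le> n\<close> by simp
    qed (use A in simp)
    then show False using det_0_iff_vec_prod_zero_field[OF A] det v by blast
  qed
  have colk: "col M k \<in> set (cols M)" "col M k \<in> carrier_vec n"
    using M k by (auto simp: cols_def)
  have "col M k \<in> span ?S"
  proof (rule ccontr)
    assume ns: "col M k \<notin> span ?S"
    then have "col M k \<notin> ?S" using in_own_span[OF carS] by auto
    moreover have "lin_indpt (insert (col M k) ?S)"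
      using lin_dep_iff_in_span[of ?S "col M k"] carS indep colk ns calculation by auto
    moreover have "insert (col M k) ?S \<subseteq> set (cols M)"
      using colk S M \<open>r \<le> n\<close> by (auto simp: cols_def)
    ultimately have "Suc r \<le> rank M"
      using rank_ge_card_indpt[OF M, of "insert (col M k) ?S"] cardS by simp
    then show False using rank by simp
  qed
  have dot: "vec n y \<bullet> col M j = (\<Sum>i<n. y i * M $$ (i, j))" if "j < n" for j
    using M that by (auto simp: scalar_prod_def atLeast0LessThan intro!: sum.cong)
  have "vec n y \<in> orthogonal_complement ?S"
    using y dot \<open>r \<le> n\<close> by (auto simp: orthogonal_complement_def S)
  then have "vec n y \<in> orthogonal_complement (span ?S)"
    using in_orthogonal_complement_span[OF carS] by simp
  then show ?thesis
    using \<open>col M k \<in> span ?S\<close> dot[OF k] by (auto simp: orthogonal_complement_def)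
qed

text \<open>
  The determinants in the definition of \<open>d_coeff\<close> are those of Cramer's rule for the system that
  writes the truncated row \<open>j\<close> as a combination of the rows of the leading block.
\<close>
lemma d_coeff_row_expansion:
  assumes det: "det (leading_block r M) \<noteq> 0" and k: "k < r"
  shows "(\<Sum>i<r. d_coeff r M i j * M $$ (i, k)) = M $$ (j, k)"
proof -
  let ?A = "leading_block r M"
  let ?T = "transpose_mat ?A"
  have A: "?A \<in> carrier_mat r r" by (simp add: leading_block_def)
  then have T: "?T \<in> carrier_mat r r" by simp
  have detT: "det ?T \<noteq> 0" using det det_transpose[OF A] by simp
  obtain Q where Q: "Q \<in> carrier_mat r r" "?T * Q = 1\<^sub>m r"
    using det_non_zero_imp_unit[OF T detT] T unfolding Units_def by (auto simp: ring_mat_simps)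
  define b where "b = vec r (\<lambda>k. M $$ (j, k))"
  define x where "x = Q *\<^sub>v b"
  have b: "b \<in> carrier_vec r" by (simp add: b_def)
  have x: "x \<in> carrier_vec r" using Q b by (simp add: x_def)
  have Tx: "?T *\<^sub>v x = b"
    using T Q b unfolding x_def by (metis assoc_mult_mat_vec one_mult_mat_vec)
  have d: "d_coeff r M i j = x $ i" if "i < r" for i
    using cramer_lemma_mat[OF T x that] det det_transpose[OF A]
    unfolding d_coeff_def Tx b_def by simp
  have "(\<Sum>i<r. d_coeff r M i j * M $$ (i, k)) = (?T *\<^sub>v x) $ k"
    using k x by (auto simp: d leading_block_def scalar_prod_def atLeast0LessThan mult.commute
        intro!: sum.cong)
  then show ?thesis using k by (simp add: Tx b_def)
qed

text \<open>
  Substituting the expansion of the rows \<open>j \<ge> r\<close> turns the first \<open>r\<close> equations of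
  \<open>y M = 0\<close> into \<open>z A = 0\<close>, where \<open>A\<close> is the leading block and
  \<open>z\<^sub>i = y\<^sub>i + \<Sum>\<^sub>j d\<^sub>i\<^sub>j y\<^sub>j\<close>; as \<open>A\<close> is invertible, \<open>z = 0\<close>.
\<close>
lemma left_kernel_iff:
  fixes M :: "'a::field mat"
  assumes M: "M \<in> carrier_mat n n" and "r \<le> n"
    and rank: "vec_space.rank n M = r"
    and det: "det (leading_block r M) \<noteq> 0"
  shows "(\<forall>k<n. (\<Sum>i<n. y i * M $$ (i, k)) = 0) \<longleftrightarrow>
    (\<forall>i<r. y i + (\<Sum>j=r..<n. d_coeff r M i j * y j) = 0)"
proof -
  define z where "z = (\<lambda>i. y i + (\<Sum>j=r..<n. d_coeff r M i j * y j))"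
  let ?A = "leading_block r M"
  have A: "?A \<in> carrier_mat r r" by (simp add: leading_block_def)
  have sum_z: "(\<Sum>i<n. y i * M $$ (i, k)) = (\<Sum>i<r. z i * M $$ (i, k))" if k: "k < r" for k
  proof -
    have "(\<Sum>i<r. z i * M $$ (i, k))
      = (\<Sum>i<r. y i * M $$ (i, k)) + (\<Sum>i<r. \<Sum>j=r..<n. d_coeff r M i j * y j * M $$ (i, k))"
      by (simp add: z_def distrib_right sum.distrib sum_distrib_right)
    also have "(\<Sum>i<r. \<Sum>j=r..<n. d_coeff r M i j * y j * M $$ (i, k))
      = (\<Sum>j=r..<n. y j * (\<Sum>i<r. d_coeff r M i j * M $$ (i, k)))"
      by (subst sum.swap) (simp add: sum_distrib_left mult_ac)
    also have "\<dots> = (\<Sum>j=r..<n. y j * M $$ (j, k))"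
      by (simp add: d_coeff_row_expansion[OF det k])
    also have "(\<Sum>i<r. y i * M $$ (i, k)) + \<dots> = (\<Sum>i<n. y i * M $$ (i, k))"
      using \<open>r \<le> n\<close> by (simp add: sum.atLeastLessThan_concat flip: atLeast0LessThan)
    finally show ?thesis ..
  qed
  have "(\<forall>k<n. (\<Sum>i<n. y i * M $$ (i, k)) = 0) \<longleftrightarrow> (\<forall>k<r. (\<Sum>i<n. y i * M $$ (i, k)) = 0)"
    using leading_columns_determine_left_kernel[OF assms] \<open>r \<le> n\<close> by auto
  also have "\<dots> \<longleftrightarrow> (\<forall>k<r. (\<Sum>i<r. z i * M $$ (i, k)) = 0)"
    using sum_z by simp
  also have "\<dots> \<longleftrightarrow> (\<forall>i<r. z i = 0)"
  proof
    assume 0: "\<forall>k<r. (\<Sum>i<r. z i * M $$ (i, k)) = 0"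
    have "transpose_mat ?A *\<^sub>v vec r z = 0\<^sub>v r"
    proof (rule eq_vecI)
      fix k assume "k < dim_vec (0\<^sub>v r :: 'a vec)"
      then have k: "k < r" by simp
      have "(transpose_mat ?A *\<^sub>v vec r z) $ k = (\<Sum>i<r. z i * M $$ (i, k))"
        using k by (auto simp: leading_block_def scalar_prod_def atLeast0LessThan mult.commute
            intro!: sum.cong)
      then show "(transpose_mat ?A *\<^sub>v vec r z) $ k = 0\<^sub>v r $ k" using 0 k by simp
    qed (use A in simp)
    then have "vec r z = 0\<^sub>v r"
      using det_0_iff_vec_prod_zero_field[of "transpose_mat ?A" r] A det det_transpose[OF A]
      by (metis transpose_carrier_mat vec_carrier)
    then show "\<forall>i<r. z i = 0" by (metis index_vec index_zero_vec(1))
  qed simp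
  finally show ?thesis by (simp add: z_def)
qed

section \<open>Half-planes covering the closed quadrant\<close>

text \<open>
  If none of the alternatives holds although both boundary rays are covered, every index with
  \<open>p\<^sub>i > 0\<close> has \<open>q\<^sub>i < 0\<close>, every index with \<open>q\<^sub>i > 0\<close> has
  \<open>p\<^sub>i < 0\<close>, and the ray through \<open>(Max T, 1)\<close> escapes all half-planes:
  \<open>T\<close> collects the upper end points of the intervals \<open>w < - q\<^sub>t / p\<^sub>t\<close>, \<open>S\<close> the lower end points of
  \<open>w > - q\<^sub>s / p\<^sub>s\<close>, and all these intervals are open. Conversely, an uncovered interior ray has parameter
  at least \<open>Max T\<close> and at most \<open>Min S\<close>.
\<close>
lemma half_planes_cover_quadrant_iff:
  fixes p q :: "nat \<Rightarrow> real"
  shows "(\<forall>u\<ge>0. \<forall>v\<ge>0. (\<forall>i<r. p i * u + q i * v \<le> 0) \<longrightarrow> u = 0 \<and> v = 0) \<longleftrightarrow>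
    (\<exists>i<r. p i > 0 \<and> q i > 0) \<or>
    (\<exists>k<r. \<exists>m<r. (p k > 0 \<and> q k = 0 \<and> q m > 0) \<or> (p k = 0 \<and> q k > 0 \<and> p m > 0)) \<or>
    ((\<exists>s<r. \<exists>t<r. p s > 0 \<and> q s < 0 \<and> p t < 0 \<and> q t > 0) \<and>
     Max {- q t / p t | t. t < r \<and> p t < 0 \<and> q t > 0}
       > Min {- q s / p s | s. s < r \<and> p s > 0 \<and> q s < 0})"
  (is "?cover \<longleftrightarrow> ?i \<or> ?ii \<or> (?mixed \<and> Max ?T > Min ?S)")
proof -
  have fin: "finite ?T" "finite ?S" by simp_all
  show ?thesis
  proof
    assume cover: ?cover
    have P: "\<exists>k<r. p k > 0"
      using cover[THEN spec, of 1, THEN mp, THEN spec, of 0] by (auto simp: not_le)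
    have Q: "\<exists>m<r. q m > 0"
      using cover[THEN spec, of 0, THEN mp, THEN spec, of 1] by (auto simp: not_le)
    show "?i \<or> ?ii \<or> (?mixed \<and> Max ?T > Min ?S)"
    proof (rule ccontr)
      assume neg: "\<not> ?thesis"
      have p_pos: "q i < 0" if "i < r" "p i > 0" for i
        using neg that Q by (cases "q i" "0::real" rule: linorder_cases) blast+
      have q_pos: "p i < 0" if "i < r" "q i > 0" for i
        using neg that P by (cases "p i" "0::real" rule: linorder_cases) blast+
      have mixed: ?mixed using P Q p_pos q_pos by blast
      then have ne: "?T \<noteq> {}" "?S \<noteq> {}" by blast+
      have le: "Max ?T \<le> Min ?S" using neg mixed by (meson not_le)
      define u where "u = Max ?T"
      have "u \<in> ?T" unfolding u_def by (rule Max_in[OF fin(1) ne(1)])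
      then have "u > 0" by (auto simp: divide_pos_neg)
      have "p i * u + q i * 1 \<le> 0" if i: "i < r" for i
      proof (cases "p i" "0::real" rule: linorder_cases)
        case less
        show ?thesis
        proof (cases "q i > 0")
          case True
          then have "- q i / p i \<le> u"
            unfolding u_def using less i by (intro Max_ge[OF fin(1)]) auto
          then show ?thesis using less by (simp add: field_simps)
        next
          case False
          then show ?thesis using less \<open>u > 0\<close> mult_neg_pos[of "p i" u] by linarith
        qed
      next
        case equal
        then show ?thesis using q_pos[OF i] by force
      next
        case greater
        then have "Min ?S \<le> - q i / p i"
          using p_pos[OF i] i by (intro Min_le[OF fin(2)]) auto
        then have "u \<le> - q i / p i" using le unfolding u_def by (rule order_trans[rotated])
        then show ?thesis using greater by (simp add: field_simps)
      qed
      then show False using cover[THEN spec, of u, THEN mp, THEN spec, of 1] \<open>u > 0\<close> by auto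
    qed
  next
    assume cond: "?i \<or> ?ii \<or> (?mixed \<and> Max ?T > Min ?S)"
    have P: "\<exists>k<r. p k > 0" and Q: "\<exists>m<r. q m > 0" using cond by blast+
    show ?cover
    proof (intro allI impI, rule ccontr)
      fix u v :: real
      assume uv: "0 \<le> u" "0 \<le> v" and le: "\<forall>i<r. p i * u + q i * v \<le> 0"
        and "\<not> (u = 0 \<and> v = 0)"
      have u: "u > 0"
      proof (rule ccontr)
        assume "\<not> u > 0"
        then have "u = 0" "v > 0" using uv \<open>\<not> (u = 0 \<and> v = 0)\<close> by auto
        moreover obtain m where "m < r" "q m > 0" using Q by blast
        ultimately show False using le mult_pos_pos[of "q m" v] by fastforce
      qed
      have v: "v > 0"
      proof (rule ccontr)
        assume "\<not> v > 0"
        then have "v = 0" using uv by auto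
        moreover obtain k where "k < r" "p k > 0" using P by blast
        ultimately show False using le u mult_pos_pos[of "p k" u] by fastforce
      qed
      have not_nonneg: "\<not> (p i \<ge> 0 \<and> q i \<ge> 0 \<and> (p i > 0 \<or> q i > 0))" if i: "i < r" for i
      proof
        assume pq: "p i \<ge> 0 \<and> q i \<ge> 0 \<and> (p i > 0 \<or> q i > 0)"
        then have "p i * u \<ge> 0" "q i * v \<ge> 0" "p i * u > 0 \<or> q i * v > 0"
          using u v by auto
        then show False using le i by fastforce
      qed
      have "\<not> ?i" "\<not> ?ii" using not_nonneg by force+
      then have ?mixed and gt: "Max ?T > Min ?S" using cond by blast+
      then have ne: "?T \<noteq> {}" "?S \<noteq> {}" by blast+
      obtain t where t: "t < r" "p t < 0" "q t > 0" "Max ?T = - q t / p t"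
        using Max_in[OF fin(1) ne(1)] by blast
      obtain s where s: "s < r" "p s > 0" "q s < 0" "Min ?S = - q s / p s"
        using Min_in[OF fin(2) ne(2)] by blast
      have "- q t / p t \<le> u / v"
        using le[rule_format, OF t(1)] t(2) v by (simp add: field_simps)
      moreover have "u / v \<le> - q s / p s"
        using le[rule_format, OF s(1)] s(2) v by (simp add: field_simps)
      ultimately show False using gt t s by simp
    qed
  qed
qed

section \<open>Uniqueness of the absolute nilpotent element\<close>

theorem theorem2:
  fixes n :: nat
    and mul :: "real vec \<Rightarrow> real vec \<Rightarrow> real vec"
    and e :: "nat \<Rightarrow> real vec"
    and M :: "real mat"
    and d :: "nat \<Rightarrow> nat \<Rightarrow> real"
  defines "d \<equiv> d_coeff (n - 2) M"
  assumes "n \<ge> 2"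
    and "evolution_algebra n mul e M"
    and "vec_space.rank n M = n - 2"
    and "det (leading_block (n - 2) M) \<noteq> 0"
  shows "{x. absolute_nilpotent n mul x} = {0\<^sub>v n} \<longleftrightarrow>
    (\<exists>i<n - 2. d i (n - 2) > 0 \<and> d i (n - 1) > 0) \<or>
    (\<exists>k<n - 2. \<exists>m<n - 2.
        (d k (n - 2) > 0 \<and> d k (n - 1) = 0 \<and> d m (n - 1) > 0) \<or>
        (d k (n - 2) = 0 \<and> d k (n - 1) > 0 \<and> d m (n - 2) > 0)) \<or>
    ((\<exists>s<n - 2. \<exists>t<n - 2.
        d s (n - 2) > 0 \<and> d s (n - 1) < 0 \<and> d t (n - 2) < 0 \<and> d t (n - 1) > 0) \<and>
     Max {- d t (n - 1) / d t (n - 2) | t. t < n - 2 \<and> d t (n - 2) < 0 \<and> d t (n - 1) > 0}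
       > Min {- d s (n - 1) / d s (n - 2) | s. s < n - 2 \<and> d s (n - 2) > 0 \<and> d s (n - 1) < 0})"
proof -
  define r where "r = n - 2"
  have r: "n - 2 = r" "n - 1 = r + 1" "n = r + 2" "r \<le> n" "r < n" "r + 1 < n"
    using assms(2) by (auto simp: r_def)
  have M: "M \<in> carrier_mat n n" using assms(3) by (simp add: evolution_algebra_def)
  have ker: "(\<forall>k<n. (\<Sum>i<n. y i * M $$ (i, k)) = 0) \<longleftrightarrow>
      (\<forall>i<r. y i + (d i r * y r + d i (r + 1) * y (r + 1)) = 0)" for y
  proof -
    have range: "{r..<n} = {r, r + 1}" using r by auto
    show ?thesis
      using left_kernel_iff[OF M r(4), of y] assms(4,5) unfolding range d_def r(1) by simp
  qed
  have below: "i < r \<or> i = r \<or> i = r + 1" if "i < n" for i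
    using that r by auto
  have "{x. absolute_nilpotent n mul x} = {0\<^sub>v n} \<longleftrightarrow>
      (\<forall>c. (\<forall>i<r. (c i)\<^sup>2 + (d i r * (c r)\<^sup>2 + d i (r + 1) * (c (r + 1))\<^sup>2) = 0)
        \<longrightarrow> (\<forall>i<n. c i = 0))"
    unfolding unique_absolute_nilpotent_iff[OF assms(3)] ker ..
  also have "\<dots> \<longleftrightarrow>
      (\<forall>u\<ge>0. \<forall>v\<ge>0. (\<forall>i<r. d i r * u + d i (r + 1) * v \<le> 0) \<longrightarrow> u = 0 \<and> v = 0)"
    (is "?L \<longleftrightarrow> ?R")
  proof
    assume L: ?L
    show ?R
    proof (intro allI impI)
      fix u v :: real
      assume uv: "0 \<le> u" "0 \<le> v" and le: "\<forall>i<r. d i r * u + d i (r + 1) * v \<le> 0"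
      \<comment> \<open>All radicands are nonnegative: these are the square roots of the kernel vector over \<open>(u, v)\<close>.\<close>
      define c where "c = (\<lambda>i. if i = r then sqrt u else if i = r + 1 then sqrt v
        else sqrt (- (d i r * u + d i (r + 1) * v)))"
      have "\<forall>i<n. c i = 0"
        by (rule L[THEN spec, THEN mp]) (use uv le in \<open>auto simp: c_def\<close>)
      then have "c r = 0" "c (r + 1) = 0" using r by auto
      then show "u = 0 \<and> v = 0" using uv by (simp add: c_def)
    qed
  next
    assume R: ?R
    show ?L
    proof (intro allI impI)
      fix c :: "nat \<Rightarrow> real" and i
      assume c: "\<forall>i<r. (c i)\<^sup>2 + (d i r * (c r)\<^sup>2 + d i (r + 1) * (c (r + 1))\<^sup>2) = 0"
        and i: "i < n"
      have "\<forall>i<r. d i r * (c r)\<^sup>2 + d i (r + 1) * (c (r + 1))\<^sup>2 \<le> 0"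
      proof (intro allI impI)
        fix i assume "i < r"
        then show "d i r * (c r)\<^sup>2 + d i (r + 1) * (c (r + 1))\<^sup>2 \<le> 0"
          using c zero_le_power2[of "c i"] by (smt (verit))
      qed
      then have "c r = 0" "c (r + 1) = 0"
        using R[THEN spec, of "(c r)\<^sup>2", THEN mp, THEN spec, of "(c (r + 1))\<^sup>2"] by auto
      then show "c i = 0" using c below[OF i] by auto
    qed
  qed
  finally show ?thesis
    unfolding r(1,2) half_planes_cover_quadrant_iff .
qed

end
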